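(* Let $n\ge 1$ and let $h(\det G_n)$ denote the truncation of $\det G_n$ to its terms of maximal degree, i.e. the sum of its terms of total degree $n(n+1)\binom{2n}{n}$. Let $C_n=\frac{1}{n+1}\binom{2n}{n}$ and let $A_1,\dots,A_{C_n}$ be the partition of $\mathbf{B}_n$ into the classes of diagrams having the same underlying Catalan state (so $b_i,b_j$ lie in the same $A_k$ iff $\gamma(b_i)=\gamma(b_j)$). Then $$h(\det G_n)=\prod_{k=1}^{C_n}\det\langle A_k,A_k\rangle,$$ where $\langle A_k,A_k\rangle$ is the square submatrix of $G_n$ with rows and columns indexed by $A_k$.
   Context: Diagrams. For $n\ge 1$, consider the closed unit disk $D^2$ with two labelled holes $X_1,Y_1$ in its interior and $2n$ marked points $a_0,\dots,a_{2n-1}$ arranged counter-clockwise on the outer boundary circle. $\mathbf{B}_n$ is the set of diagrams consisting of $n$ non-crossing chords (disjoint arcs in the disk with two holes) connecting the $2n$ points in pairs, up to the following equivalence: two diagrams are equivalent iff filling in the holes gives the same crossingless chord diagram in the disk (the underlying Catalan state $\gamma(b)$) and the labelled holes $X_1,Y_1$ are distributed in the same way among the $n+1$ regions into which the chords cut the disk. Thus an element of $\mathbf{B}_n$ is a non-crossing perfect matching of $a_0,\dots,a_{2n-1}$ together with an assignment of each of $X_1,Y_1$ to one of the $n+1$ regions, and $|\mathbf{B}_n|=(n+1)\binom{2n}{n}$. Pairing. For $b_j\in\mathbf{B}_n$ let $b_j^*$ be its image under the inversion $z\mapsto z/|z|^2$ of the sphere $\mathbb{C}\cup\{\infty\}$;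 it lies outside the unit disk, and the images of the holes $X_1,Y_1$ are denoted $X_2,Y_2$. Gluing $b_i$ with $b_j^*$ along the unit circle (matching the marked points) gives a diagram $b_i\circ b_j^*$ of at most $n$ disjoint closed curves on the sphere with four holes $X_1,Y_1$ (coming from $b_i$) and $X_2,Y_2$ (coming from $b_j^*$). Each closed curve splits $\{X_1,X_2,Y_1,Y_2\}$ into two (possibly empty) sides and is assigned a variable: $d$ if all four holes are on one side; $x_1,x_2,y_1,y_2$ if it separates, respectively, $X_1$, $X_2$, $Y_1$, $Y_2$ from the other three; $z_1$ if it separates $\{X_1,X_2\}$ from $\{Y_1,Y_2\}$; $z_2$ if it separates $\{X_1,Y_1\}$ from $\{X_2,Y_2\}$; $z_3$ if it separates $\{X_1,Y_2\}$ from $\{X_2,Y_1\}$. Then $\langle b_i,b_j\rangle\in R=\mathbb{Z}[d,x_1,x_2,y_1,y_2,z_1,z_2,z_3]$ is the product of the variables of all closed curves of $b_i\circ b_j^*$; it is a monomial of degree at most $n$. Gram matrix. $G_n=(\langle b_i,b_j\rangle)_{b_i,b_j\in\mathbf{B}_n}$, with the same ordering of $\mathbf{B}_n$ used for rows and columns. *)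

theory Defs
  imports
    "HOL-Library.Disjoint_Sets"
    "HOL-Library.Poly_Mapping"
    "Jordan_Normal_Form.Determinant"
    "Jordan_Normal_Form.DL_Submatrix"
begin

text \<open>
  The marked points \<open>a_0, \<dots>, a_(2n-1)\<close> on the unit circle are the numbers below \<open>2 * n\<close>. They cut
  the circle into \<open>2 * n\<close> open boundary arcs; arc \<open>k\<close> runs counter-clockwise from \<open>a_k\<close> to
  \<open>a_((k+1) mod 2n)\<close>. A Catalan state is given by its set of chords, a chord being the
  two-element set of its endpoints.
\<close>

definition catalan_states :: "nat \<Rightarrow> nat set set set" where
  "catalan_states n =
    {M. partition_on {..<2 * n} M \<and> (\<forall>e\<in>M. card e = 2) \<and>
        \<not> (\<exists>a b c d. a < b \<and> b < c \<and> c < d \<and> {a, c} \<in> M \<and> {b, d} \<in> M)}"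

text \<open>
  The chord from \<open>a_p\<close> to \<open>a_q\<close>, \<open>p < q\<close>, cuts the disk into two parts; the boundary arcs of one
  part are those with \<open>p \<le> k < q\<close>.
\<close>

definition chord_separates :: "nat set \<Rightarrow> nat \<Rightarrow> nat \<Rightarrow> bool" where
  "chord_separates e k l \<longleftrightarrow> (k \<in> {Min e..<Max e}) \<noteq> (l \<in> {Min e..<Max e})"

text \<open>
  Each component of the complement in the disk of a set \<open>M\<close> of non-crossing chords has some
  boundary arc on its boundary, and two arcs lie on the same component iff no chord of \<open>M\<close>
  separates them. A region is represented by its set of boundary arcs.
\<close>

definition same_region :: "nat \<Rightarrow> nat set set \<Rightarrow> (nat \<times> nat) set" where
  "same_region n M =
    {(k, l). k < 2 * n \<and> l < 2 * n \<and> \<not> (\<exists>e\<in>M. chord_separates e k l)}"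

definition regions :: "nat \<Rightarrow> nat set set \<Rightarrow> nat set set" where
  "regions n M = {..<2 * n} // same_region n M"

text \<open>
  The underlying Catalan state, the region containing the hole \<open>X_1\<close> and the region containing
  the hole \<open>Y_1\<close>.
\<close>

type_synonym diagram = "nat set set \<times> nat set \<times> nat set"

definition diagrams :: "nat \<Rightarrow> diagram set" where
  "diagrams n = {(M, r, s). M \<in> catalan_states n \<and> r \<in> regions n M \<and> s \<in> regions n M}"

definition catalan_state :: "diagram \<Rightarrow> nat set set" where
  "catalan_state b = fst b"

definition state_classes :: "nat \<Rightarrow> diagram set set" where
  "state_classes n =
    diagrams n // {(b, b'). b \<in> diagrams n \<and> b' \<in> diagrams n \<and> catalan_state b = catalan_state b'}"

definition catalan_number :: "nat \<Rightarrow> nat" where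
  "catalan_number n = (2 * n choose n) div (n + 1)"

text \<open>
  The inversion fixes the unit circle pointwise, so the image of a diagram outside the disk has the
  same combinatorial data. A closed curve of the glued diagram is represented by the set of marked
  points it passes through; it consists of the inner and the outer chords contained in that set.
\<close>

definition closed_curves :: "nat \<Rightarrow> diagram \<Rightarrow> diagram \<Rightarrow> nat set set" where
  "closed_curves n b b' =
    {..<2 * n} // ({(p, q). {p, q} \<in> catalan_state b \<union> catalan_state b'}\<^sup>*)"

text \<open>
  The components of the complement on the sphere of a closed curve \<open>c\<close>: the components of the
  complement of its chords inside the disk and of those outside the disk, glued along the boundary
  arcs. Two arcs lie on the same component iff they are related by a chain of such pieces.
\<close>

definition same_side :: "nat \<Rightarrow> diagram \<Rightarrow> diagram \<Rightarrow> nat set \<Rightarrow> (nat \<times> nat) set" where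
  "same_side n b b' c =
    (same_region n {e \<in> catalan_state b. e \<subseteq> c} \<union>
     same_region n {e \<in> catalan_state b'. e \<subseteq> c})\<^sup>+"

datatype hole = X1 | X2 | Y1 | Y2

fun hole_region :: "diagram \<Rightarrow> diagram \<Rightarrow> hole \<Rightarrow> nat set" where
  "hole_region b b' X1 = fst (snd b)"
| "hole_region b b' Y1 = snd (snd b)"
| "hole_region b b' X2 = fst (snd b')"
| "hole_region b b' Y2 = snd (snd b')"

definition holes_same_side ::
    "nat \<Rightarrow> diagram \<Rightarrow> diagram \<Rightarrow> nat set \<Rightarrow> hole \<Rightarrow> hole \<Rightarrow> bool" where
  "holes_same_side n b b' c g h \<longleftrightarrow>
    (\<exists>k\<in>hole_region b b' g. \<exists>l\<in>hole_region b b' h. (k, l) \<in> same_side n b b' c)"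

text \<open>The curve \<open>c\<close> has exactly the holes in \<open>S\<close> on one side and the remaining ones on the other.\<close>

definition splits :: "nat \<Rightarrow> diagram \<Rightarrow> diagram \<Rightarrow> nat set \<Rightarrow> hole set \<Rightarrow> bool" where
  "splits n b b' c S \<longleftrightarrow> (\<forall>g h. holes_same_side n b b' c g h \<longleftrightarrow> (g \<in> S \<longleftrightarrow> h \<in> S))"

datatype gram_var =
  Var_d | Var_x1 | Var_x2 | Var_y1 | Var_y2 | Var_z1 | Var_z2 | Var_z3

text \<open>
  The eight cases are all the ways to split the four holes into two unordered sides; the last
  one is the splitting into \<open>{X1, Y2}\<close> and \<open>{X2, Y1}\<close>.
\<close>

definition curve_var :: "nat \<Rightarrow> diagram \<Rightarrow> diagram \<Rightarrow> nat set \<Rightarrow> gram_var" where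
  "curve_var n b b' c =
    (if splits n b b' c {} then Var_d
     else if splits n b b' c {X1} then Var_x1
     else if splits n b b' c {X2} then Var_x2
     else if splits n b b' c {Y1} then Var_y1
     else if splits n b b' c {Y2} then Var_y2
     else if splits n b b' c {X1, X2} then Var_z1
     else if splits n b b' c {X1, Y1} then Var_z2
     else Var_z3)"

text \<open>
  The ring \<open>\<int>[d, x_1, x_2, y_1, y_2, z_1, z_2, z_3]\<close>: a monomial is a function from variables to
  exponents, a polynomial a finitely supported function from monomials to coefficients.
\<close>

type_synonym gram_poly = "(gram_var \<Rightarrow>\<^sub>0 nat) \<Rightarrow>\<^sub>0 int"

definition poly_var :: "gram_var \<Rightarrow> gram_poly" where
  "poly_var v = Poly_Mapping.single (Poly_Mapping.single v 1) 1"

definition total_degree :: "(gram_var \<Rightarrow>\<^sub>0 nat) \<Rightarrow> nat" where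
  "total_degree m = (\<Sum>v\<in>Poly_Mapping.keys m. Poly_Mapping.lookup m v)"

definition homogeneous_part :: "nat \<Rightarrow> gram_poly \<Rightarrow> gram_poly" where
  "homogeneous_part N p =
    (\<Sum>m\<in>{m \<in> Poly_Mapping.keys p. total_degree m = N}.
      Poly_Mapping.single m (Poly_Mapping.lookup p m))"

definition pairing :: "nat \<Rightarrow> diagram \<Rightarrow> diagram \<Rightarrow> gram_poly" where
  "pairing n b b' = (\<Prod>c\<in>closed_curves n b b'. poly_var (curve_var n b b' c))"

text \<open>The list \<open>bs\<close> is the ordering of the diagrams, used for both rows and columns.\<close>

definition gram_matrix :: "nat \<Rightarrow> diagram list \<Rightarrow> gram_poly mat" where
  "gram_matrix n bs = mat (length bs) (length bs) (\<lambda>(i, j). pairing n (bs ! i) (bs ! j))"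

definition gram_block :: "nat \<Rightarrow> diagram list \<Rightarrow> diagram set \<Rightarrow> gram_poly mat" where
  "gram_block n bs A =
    submatrix (gram_matrix n bs) {i. i < length bs \<and> bs ! i \<in> A} {i. i < length bs \<and> bs ! i \<in> A}"

end

theory Submission
  imports Defs
begin

text \<open>
  A closed curve passes through at least two of the \<open>2 * n\<close> marked points, so a pairing has degree at
  most \<open>n\<close>, with equality iff every curve consists of one inner and one outer chord with the same
  endpoints, i.e. iff the two Catalan states agree. Hence only the permutations preserving every state
  class contribute to the top degree of the Leibniz expansion, and the truncated matrix is block diagonal.
  The degree is \<open>n\<close> times the number of diagrams: a state has one region for each chord plus the outer
  one, and the states are counted by a ballot recurrence.
\<close>

section \<open>Determinants over finite index sets\<close>

text \<open>The Leibniz formula over an arbitrary finite index set: the blocks of the Gram matrix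
  sit at scattered positions, and this form factors over them without renumbering.\<close>

definition set_det :: "'a set \<Rightarrow> ('a \<Rightarrow> 'a \<Rightarrow> 'b::comm_ring_1) \<Rightarrow> 'b" where
  "set_det S f = (\<Sum>p | p permutes S. of_int (sign p) * (\<Prod>i\<in>S. f i (p i)))"

lemma det_mat_eq_set_det: "det (mat m m (\<lambda>(i, j). f i j)) = set_det {..<m} f"
  unfolding det_def'[OF mat_carrier] set_det_def
  by (intro sum.cong arg_cong2[where f = times] refl prod.cong)
     (auto simp: atLeast0LessThan permutes_in_image)

lemma set_det_cong:
  assumes "\<And>i j. i \<in> S \<Longrightarrow> j \<in> S \<Longrightarrow> f i j = g i j"
  shows "set_det S f = set_det S g"
  unfolding set_det_def
  by (intro sum.cong arg_cong2[where f = times] refl prod.cong) (auto simp: assms permutes_in_image)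

text \<open>Transport along \<open>g\<close> turns the permutations of \<open>S\<close> into those
  of \<open>T\<close>, preserves signs, and matches the products factor by factor.\<close>

lemma set_det_reindex:
  assumes "finite S" and bij: "bij_betw g S T"
  shows "set_det S (\<lambda>i j. f (g i) (g j)) = set_det T f"
  unfolding set_det_def
proof (rule sum.reindex_bij_witness[where i = "map_permutation T (inv_into S g)" and j = "map_permutation S g"])
  have inj: "inj_on g S" using bij by (simp add: bij_betw_def)
  fix p assume "p \<in> {p. p permutes S}"
  then have p: "p permutes S" by simp
  show "map_permutation T (inv_into S g) (map_permutation S g p) = p"
    by (rule map_permutation_compose_inv[OF bij p]) (simp add: inj)
  show "map_permutation S g p \<in> {p. p permutes T}"
    using map_permutation_permutes[OF bij p] by simp
  have "(\<Prod>i\<in>T. f i (map_permutation S g p i)) = (\<Prod>i\<in>S. f (g i) (map_permutation S g p (g i)))"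
    by (rule prod.reindex_bij_betw[OF bij, symmetric])
  also have "\<dots> = (\<Prod>i\<in>S. f (g i) (g (p i)))"
    by (rule prod.cong) (simp_all add: map_permutation_apply[OF inj])
  finally show "of_int (sign (map_permutation S g p)) * (\<Prod>i\<in>T. f i (map_permutation S g p i)) =
      of_int (sign p) * (\<Prod>i\<in>S. f (g i) (g (p i)))"
    using sign_map_permutation[OF inj p \<open>finite S\<close>] by simp
next
  have bij': "bij_betw (inv_into S g) T S" using bij by (rule bij_betw_inv_into)
  fix p assume "p \<in> {p. p permutes T}"
  then have p: "p permutes T" by simp
  show "map_permutation S g (map_permutation T (inv_into S g) p) = p"
    by (rule map_permutation_compose_inv[OF bij' p]) (use bij in \<open>auto simp: bij_betw_def f_inv_into_f\<close>)
  show "map_permutation T (inv_into S g) p \<in> {p. p permutes S}"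
    using map_permutation_permutes[OF bij' p] by simp
qed

text \<open>A permutation that moves some point of \<open>A\<close> into \<open>B\<close> picks a
  zero entry. The surviving ones preserve both blocks, so each is a permutation of \<open>A\<close>
  times one of \<open>B\<close>, and the sum factors.\<close>

lemma set_det_block_triangular:
  fixes f :: "'a \<Rightarrow> 'a \<Rightarrow> 'b::comm_ring_1"
  assumes fin: "finite A" "finite B" and disj: "A \<inter> B = {}"
    and zero: "\<And>i j. i \<in> A \<Longrightarrow> j \<in> B \<Longrightarrow> f i j = 0"
  shows "set_det (A \<union> B) f = set_det A f * set_det B f"
proof -
  let ?t = "\<lambda>S p. of_int (sign p) * (\<Prod>i\<in>S. f i (p i)) :: 'b"
  let ?P = "{p. p permutes A \<union> B \<and> p ` A \<subseteq> A}"
  have "set_det (A \<union> B) f = sum (?t (A \<union> B)) ?P"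
    unfolding set_det_def
  proof (rule sum.mono_neutral_right)
    show "finite {p. p permutes A \<union> B}" using fin by (simp add: finite_permutations)
    show "\<forall>p\<in>{p. p permutes A \<union> B} - ?P. ?t (A \<union> B) p = 0"
    proof
      fix p assume p: "p \<in> {p. p permutes A \<union> B} - ?P"
      then obtain i where i: "i \<in> A" "p i \<notin> A" by auto
      then have "p i \<in> B" using p permutes_in_image[of p "A \<union> B" i] by auto
      then have "(\<Prod>i\<in>A \<union> B. f i (p i)) = 0"
        using i zero fin by (intro prod_zero) auto
      then show "?t (A \<union> B) p = 0" by simp
    qed
  qed auto
  \<comment> \<open>Splitting \<open>p\<close> into its restrictions, each extended by the identity,
    is inverse to composing a permutation of \<open>A\<close> with one of \<open>B\<close>.\<close>
  also have "\<dots> = (\<Sum>(p, q)\<in>{p. p permutes A} \<times> {q. q permutes B}. ?t A p * ?t B q)"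
  proof (rule sum.reindex_bij_witness[where i = "\<lambda>(p, q). p \<circ> q"
        and j = "\<lambda>p. (restrict_id p A, restrict_id p B)"])
    fix p assume "p \<in> ?P"
    then have p: "p permutes A \<union> B" and pA: "p ` A = A"
      using fin endo_inj_surj[of A p] permutes_inj_on[of p _ A] by auto
    have pB: "p ` B = B"
    proof -
      have "p ` B = p ` ((A \<union> B) - A)" using disj by (intro arg_cong[where f = "image p"]) auto
      also have "\<dots> = p ` (A \<union> B) - p ` A" using permutes_inj[OF p] by (rule image_set_diff)
      finally show ?thesis using pA permutes_image[OF p] disj by auto
    qed
    have rA: "restrict_id p A permutes A" and rB: "restrict_id p B permutes B"
      using pA pB p by (auto intro!: permutes_restrict_id simp: bij_betw_def permutes_inj_on)
    have comp: "restrict_id p A \<circ> restrict_id p B = p"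
    proof
      fix x
      have "p x \<notin> A" if "x \<in> B" using that pB disj by auto
      then show "(restrict_id p A \<circ> restrict_id p B) x = p x"
        using permutes_not_in[OF p, of x] disj by (auto simp: restrict_id_def)
    qed
    show "(case (restrict_id p A, restrict_id p B) of (p, q) \<Rightarrow> p \<circ> q) = p"
      using comp by simp
    show "(restrict_id p A, restrict_id p B) \<in> {p. p permutes A} \<times> {q. q permutes B}"
      using rA rB by simp
    have "sign p = sign (restrict_id p A) * sign (restrict_id p B)"
      using sign_compose[of "restrict_id p A" "restrict_id p B"] comp
        permutes_imp_permutation[OF fin(1) rA] permutes_imp_permutation[OF fin(2) rB] by simp
    moreover have "(\<Prod>i\<in>A \<union> B. f i (p i)) =
        (\<Prod>i\<in>A. f i (restrict_id p A i)) * (\<Prod>i\<in>B. f i (restrict_id p B i))"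
      using fin disj by (simp add: prod.union_disjoint)
    ultimately show "(case (restrict_id p A, restrict_id p B) of (p, q) \<Rightarrow> ?t A p * ?t B q) = ?t (A \<union> B) p"
      by (simp add: mult_ac)
  next
    fix pq assume "pq \<in> {p. p permutes A} \<times> {q. q permutes B}"
    then obtain p q where pq: "pq = (p, q)" and p: "p permutes A" and q: "q permutes B" by auto
    have "restrict_id (p \<circ> q) A = p"
    proof
      fix x show "restrict_id (p \<circ> q) A x = p x"
        using permutes_not_in[OF p, of x] permutes_not_in[OF q, of x] disj
        by (cases "x \<in> A"; cases "x \<in> B") (auto simp: restrict_id_def)
    qed
    moreover have "restrict_id (p \<circ> q) B = q"
    proof
      fix x
      have "q x \<notin> A" if "x \<in> B" using that permutes_in_image[OF q] disj by auto
      then show "restrict_id (p \<circ> q) B x = q x"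
        using permutes_not_in[OF p, of "q x"] permutes_not_in[OF q, of x]
        by (auto simp: restrict_id_def)
    qed
    ultimately show "(restrict_id (case pq of (p, q) \<Rightarrow> p \<circ> q) A, restrict_id (case pq of (p, q) \<Rightarrow> p \<circ> q) B) = pq"
      using pq by simp
    have "p \<circ> q permutes A \<union> B"
      using permutes_subset[OF p, of "A \<union> B"] permutes_subset[OF q, of "A \<union> B"] by (simp add: permutes_compose)
    moreover have "(p \<circ> q) ` A \<subseteq> A"
    proof
      fix y assume "y \<in> (p \<circ> q) ` A"
      then obtain x where "x \<in> A" "y = p (q x)" by auto
      moreover have "q x = x" using permutes_not_in[OF q, of x] \<open>x \<in> A\<close> disj by blast
      ultimately show "y \<in> A" using permutes_in_image[OF p] by simp
    qed
    ultimately show "(case pq of (p, q) \<Rightarrow> p \<circ> q) \<in> ?P" using pq by simp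
  qed
  also have "\<dots> = set_det A f * set_det B f"
    by (simp add: set_det_def sum_product sum.cartesian_product)
  finally show ?thesis .
qed

text \<open>Blocks are split off one at a time by the triangular case, with the new block playing
  the role of \<open>A\<close>.\<close>

lemma set_det_block_diagonal:
  assumes "finite P" "\<And>A. A \<in> P \<Longrightarrow> finite A" "disjoint P"
    and "\<And>A B i j. A \<in> P \<Longrightarrow> B \<in> P \<Longrightarrow> A \<noteq> B \<Longrightarrow> i \<in> A \<Longrightarrow> j \<in> B \<Longrightarrow> f i j = 0"
  shows "set_det (\<Union>P) f = (\<Prod>A\<in>P. set_det A f)"
  using assms
proof (induction P rule: finite_induct)
  case empty
  then show ?case by (simp add: set_det_def)
next
  case (insert A P)
  have "A \<inter> \<Union>P = {}"
    using insert.prems(2) insert.hyps(2) by (auto simp: pairwise_insert disjnt_def)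
  then have "set_det (A \<union> \<Union>P) f = set_det A f * set_det (\<Union>P) f"
  proof (intro set_det_block_triangular)
    fix i j assume i: "i \<in> A" and "j \<in> \<Union>P"
    then obtain B where "B \<in> P" "j \<in> B" by blast
    then show "f i j = 0" using insert.prems(3)[of A B i j] insert.hyps(2) i by auto
  qed (use insert.hyps insert.prems(1) in auto)
  also have "set_det (\<Union>P) f = (\<Prod>A\<in>P. set_det A f)"
  proof (rule insert.IH)
    fix A' B i j assume "A' \<in> P" "B \<in> P" "A' \<noteq> B" "i \<in> A'" "j \<in> B"
    then show "f i j = 0" using insert.prems(3)[of A' B i j] by blast
  qed (use insert.prems(1,2) in \<open>auto simp: pairwise_insert\<close>)
  finally show ?case using insert.hyps by simp
qed

text \<open>\<open>submatrix\<close> renumbers rows and columns through \<open>pick I\<close>, which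
  is a bijection from \<open>{..<card I}\<close> onto \<open>I\<close>, so reindexing undoes
  it.\<close>

lemma det_submatrix_eq_set_det:
  assumes "I \<subseteq> {..<m}"
  shows "det (submatrix (mat m m (\<lambda>(i, j). f i j)) I I) = set_det I f"
proof -
  have fin: "finite I" using assms finite_subset by blast
  have I: "{i. i < m \<and> i \<in> I} = I" using assms by auto
  have pick_I: "pick I k \<in> I" if "k < card I" for k
    using that by (rule pick_in_set_le)
  have bij: "bij_betw (pick I) {..<card I} I"
  proof (rule bij_betw_imageI)
    show inj: "inj_on (pick I) {..<card I}"
      by (auto simp: inj_on_def) (metis card_pick_le)
    show "pick I ` {..<card I} = I"
      by (rule card_subset_eq[OF fin]) (auto simp: pick_I card_image[OF inj])
  qed
  have "submatrix (mat m m (\<lambda>(i, j). f i j)) I I =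
      mat (card I) (card I) (\<lambda>(i, j). f (pick I i) (pick I j))"
    using pick_I assms by (intro eq_matI) (auto simp: submatrix_def I subset_iff)
  then show ?thesis
    by (simp add: det_mat_eq_set_det set_det_reindex[OF finite_lessThan bij])
qed

section \<open>Homogeneous parts\<close>

text \<open>Truncation is a coefficientwise cut-off; in this form its linearity is
  immediate.\<close>

lemma lookup_homogeneous_part:
  fixes p :: gram_poly
  shows
  "Poly_Mapping.lookup (homogeneous_part N p) m = (if total_degree m = N then Poly_Mapping.lookup p m else 0)"
proof -
  have "Poly_Mapping.lookup (homogeneous_part N p) m =
      (\<Sum>m'\<in>{m \<in> Poly_Mapping.keys p. total_degree m = N}. if m' = m then Poly_Mapping.lookup p m else 0)"
    unfolding homogeneous_part_def lookup_sum
    by (intro sum.cong) (auto simp: lookup_single when_def)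
  also have "\<dots> = (if total_degree m = N then Poly_Mapping.lookup p m else 0)"
    by (auto simp: in_keys_iff)
  finally show ?thesis .
qed

lemma homogeneous_part_sum: "homogeneous_part N (sum f I) = (\<Sum>i\<in>I. homogeneous_part N (f i))"
  by (rule poly_mapping_eqI) (simp add: lookup_homogeneous_part lookup_sum)

text \<open>Leibniz coefficients are 1 or -1, so compatibility with negation suffices.\<close>

lemma homogeneous_part_sign_mult:
  "homogeneous_part N (of_int (sign \<sigma>) * p) = of_int (sign \<sigma>) * homogeneous_part N p"
proof -
  have "homogeneous_part N (- p) = - homogeneous_part N p"
    by (rule poly_mapping_eqI) (simp add: lookup_homogeneous_part)
  then show ?thesis by (simp add: sign_def)
qed

lemma homogeneous_part_single:
  "homogeneous_part N (Poly_Mapping.single m 1) =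
    (if total_degree m = N then Poly_Mapping.single m 1 else 0)"
  by (rule poly_mapping_eqI) (auto simp: lookup_homogeneous_part lookup_single when_def)

text \<open>Summing over all eight variables, instead of over a support that depends on
  \<open>m\<close>, makes additivity of the degree immediate.\<close>

lemma total_degree_eq_sum: "total_degree m = (\<Sum>v\<in>{Var_d, Var_x1, Var_x2, Var_y1, Var_y2, Var_z1, Var_z2, Var_z3}. Poly_Mapping.lookup m v)"
proof -
  have "Poly_Mapping.keys m \<subseteq> {Var_d, Var_x1, Var_x2, Var_y1, Var_y2, Var_z1, Var_z2, Var_z3}"
    using gram_var.exhaust by blast
  then show ?thesis unfolding total_degree_def
    by (intro sum.mono_neutral_left) (auto simp: in_keys_iff)
qed

lemma total_degree_add: "total_degree (m + m') = total_degree m + total_degree m'"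
  by (simp add: total_degree_eq_sum lookup_add sum.distrib)

lemma total_degree_sum: "total_degree (sum f I) = (\<Sum>i\<in>I. total_degree (f i))"
proof (induction I rule: infinite_finite_induct)
  case (insert x F)
  then show ?case by (simp add: total_degree_add)
qed (simp_all add: total_degree_def)

lemma prod_single_one:
  "(\<Prod>i\<in>I. Poly_Mapping.single (f i) 1) = (Poly_Mapping.single (\<Sum>i\<in>I. f i) 1 :: gram_poly)"
  by (induction I rule: infinite_finite_induct) (simp_all add: mult_single)

definition pairing_exponent :: "nat \<Rightarrow> diagram \<Rightarrow> diagram \<Rightarrow> gram_var \<Rightarrow>\<^sub>0 nat" where
  "pairing_exponent n b b' = (\<Sum>c\<in>closed_curves n b b'. Poly_Mapping.single (curve_var n b b' c) 1)"

lemma pairing_eq_single: "pairing n b b' = Poly_Mapping.single (pairing_exponent n b b') 1"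
  unfolding pairing_def poly_var_def pairing_exponent_def by (rule prod_single_one)

text \<open>Every curve contributes exactly one variable, whichever of the eight it is, so the
  degree counts the curves.\<close>

lemma total_degree_pairing_exponent:
  "total_degree (pairing_exponent n b b') = card (closed_curves n b b')"
  by (simp add: pairing_exponent_def total_degree_sum) (simp add: total_degree_def)

section \<open>Closed curves\<close>

text \<open>The block sizes add up to \<open>card S\<close> and each is at least 2; a single larger
  block would make the inequality strict.\<close>

lemma card_partition_pairs_le:
  assumes "finite S" "partition_on S P" "\<forall>c\<in>P. 2 \<le> card c"
  shows "2 * card P \<le> card S"
    and "2 * card P = card S \<Longrightarrow> c \<in> P \<Longrightarrow> card c = 2"
proof -
  have fin: "finite P" using assms(1,2) by (rule finite_elements)
  have card: "card S = (\<Sum>c\<in>P. card c)"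
    using assms(1,2) card_Union_disjoint[of P] by (auto simp: partition_on_def intro: finite_subset)
  have le: "(\<Sum>c\<in>P. 2) \<le> (\<Sum>c\<in>P. card c)" by (rule sum_mono) (use assms(3) in blast)
  then show "2 * card P \<le> card S" using card by simp
  show "card c = 2" if "2 * card P = card S" "c \<in> P"
  proof (rule ccontr)
    assume "card c \<noteq> 2"
    then have "2 < card c" using assms(3) that(2) by (simp add: order_neq_le_trans)
    then have "(\<Sum>c\<in>P. 2) < (\<Sum>c\<in>P. card c)"
      using fin that(2) assms(3) by (intro sum_strict_mono_ex1) auto
    then show False using that(1) card by simp
  qed
qed

lemma card_matching:
  assumes "partition_on S M" "finite S" "\<forall>e\<in>M. card e = 2"
  shows "2 * card M = card S"
proof -
  have "card S = (\<Sum>e\<in>M. card e)"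
    using assms(1,2) card_Union_disjoint[of M] by (auto simp: partition_on_def intro: finite_subset)
  then show ?thesis using assms(3) by simp
qed

lemma partition_pair:
  assumes "partition_on S M" "\<forall>e\<in>M. card e = 2" "p \<in> S"
  obtains q where "{p, q} \<in> M" "p \<noteq> q"
proof -
  obtain e where "e \<in> M" "p \<in> e" using assms(1,3) by (auto simp: partition_on_def)
  moreover then obtain a b where "e = {a, b}" "a \<noteq> b" using assms(2) by (auto simp: card_2_iff)
  ultimately show thesis using that by (cases "p = a") (auto simp: insert_commute)
qed

lemma partition_on_closed_curves:
  assumes "catalan_state b \<in> catalan_states n" "catalan_state b' \<in> catalan_states n"
  shows "partition_on {..<2 * n} (closed_curves n b b')"
    and "c \<in> closed_curves n b b' \<Longrightarrow> {p, q} \<in> catalan_state b \<union> catalan_state b' \<Longrightarrow> p \<in> c \<Longrightarrow> q \<in> c"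
proof -
  define r where "r = {(p, q). {p, q} \<in> catalan_state b \<union> catalan_state b'}"
  have r: "p < 2 * n \<and> q < 2 * n" if "(p, q) \<in> r" for p q
    using that assms by (auto simp: r_def catalan_states_def partition_on_def)
  have sym: "sym (r\<^sup>*)" by (rule sym_rtrancl) (auto simp: r_def sym_def insert_commute)
  have closed: "p = q \<or> (p < 2 * n \<and> q < 2 * n)" if "(p, q) \<in> r\<^sup>*" for p q
    using that by (induction) (auto dest: r)
  \<comment> \<open>\<open>r\<^sup>*\<close> is reflexive on all natural numbers; cutting it down
    gives an equivalence on the marked points with the same classes there.\<close>
  let ?r = "r\<^sup>* \<inter> {..<2 * n} \<times> {..<2 * n}"
  have "equiv {..<2 * n} ?r"
  proof (rule equivI)
    show "sym ?r" using sym by (auto simp: sym_def)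
    show "trans ?r" by (auto simp: trans_def intro: rtrancl_trans)
  qed (auto simp: refl_on_def)
  moreover have "r\<^sup>* `` {p} = ?r `` {p}" if "p < 2 * n" for p using closed[of p] that by blast
  then have *: "closed_curves n b b' = {..<2 * n} // ?r"
    unfolding closed_curves_def r_def[symmetric] by (auto simp: quotient_def)
  ultimately show "partition_on {..<2 * n} (closed_curves n b b')"
    by (simp add: partition_on_quotient)
  show "q \<in> c" if "c \<in> closed_curves n b b'" "{p, q} \<in> catalan_state b \<union> catalan_state b'" "p \<in> c"
    using that unfolding closed_curves_def r_def[symmetric]
    by (auto simp: quotient_def r_def intro: rtrancl_into_rtrancl)
qed

text \<open>With each point a curve contains its partner in the first state, hence at least two
  points. If there are \<open>n\<close> curves, all have exactly two points, so every chord of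
  either state is itself a curve and both states coincide with the partition into curves.
  Conversely, a chord shared by both states closes up to a curve.\<close>

lemma card_closed_curves:
  assumes b: "catalan_state b \<in> catalan_states n" and b': "catalan_state b' \<in> catalan_states n"
  shows "card (closed_curves n b b') \<le> n"
    and "card (closed_curves n b b') = n \<longleftrightarrow> catalan_state b = catalan_state b'"
proof -
  let ?M = "catalan_state b" and ?M' = "catalan_state b'" and ?C = "closed_curves n b b'"
  note C = partition_on_closed_curves[OF b b']
  have M: "partition_on {..<2 * n} ?M" "\<forall>e\<in>?M. card e = 2" using b by (auto simp: catalan_states_def)
  have M': "partition_on {..<2 * n} ?M'" "\<forall>e\<in>?M'. card e = 2" using b' by (auto simp: catalan_states_def)
  have ge2: "\<forall>c\<in>?C. 2 \<le> card c"
  proof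
    fix c assume c: "c \<in> ?C"
    have sub: "c \<subseteq> {..<2 * n}" and "c \<noteq> {}" using C(1) c by (auto simp: partition_on_def)
    then obtain p where "p \<in> c" "p < 2 * n" by auto
    moreover obtain q where "{p, q} \<in> ?M" "p \<noteq> q" using partition_pair[OF M] \<open>p < 2 * n\<close> by blast
    ultimately have "{p, q} \<subseteq> c" "card {p, q} = 2" using C(2)[OF c, of p q] by auto
    then show "2 \<le> card c" using card_mono[of c "{p, q}"] finite_subset[OF sub] by auto
  qed
  note le = card_partition_pairs_le[OF finite_lessThan C(1) ge2]
  show "card ?C \<le> n" using le(1) by simp
  \<comment> \<open>Stated for a general matching \<open>N\<close> so that it applies to both the
    inner and the outer state.\<close>
  have all_eq: "N \<subseteq> ?C" if n: "card ?C = n" and N: "partition_on {..<2 * n} N" "\<forall>e\<in>N. card e = 2" "N \<subseteq> ?M \<union> ?M'" for N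
  proof
    fix e assume e: "e \<in> N"
    obtain p q where pq: "e = {p, q}" "p \<noteq> q" using e N(2) by (auto simp: card_2_iff)
    then have "p \<in> {..<2 * n}" using e N(1) by (auto simp: partition_on_def)
    then obtain c where c: "c \<in> ?C" "p \<in> c" using C(1) by (auto simp: partition_on_def)
    have "q \<in> c" using C(2)[OF c(1), of p q] c(2) e pq N(3) by auto
    moreover have "card c = 2" using le(2)[OF _ c(1)] n by simp
    ultimately have "c = e" using pq c(2) by (auto simp: card_2_iff)
    then show "e \<in> ?C" using c by simp
  qed
  \<comment> \<open>Two partitions of the same set are equal as soon as one contains the
    other.\<close>
  have eq_of_sub: "N = N'" if N: "partition_on S N" and N': "partition_on S N'" and sub: "N \<subseteq> N'"
    for N N' and S :: "nat set"
  proof (intro equalityI sub subsetI)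
    fix c assume c: "c \<in> N'"
    moreover have "c \<noteq> {}" using c partition_onD3[OF N'] by blast
    ultimately obtain p where p: "p \<in> c" "p \<in> S" using partition_onD1[OF N'] by blast
    then obtain e where e: "e \<in> N" "p \<in> e" using N by (auto simp: partition_on_def)
    have "e = c" using e disjointD[OF partition_onD2[OF N'], of e c] c p sub by blast
    then show "c \<in> N" using e by simp
  qed
  show "card ?C = n \<longleftrightarrow> ?M = ?M'"
  proof
    assume "card ?C = n"
    then show "?M = ?M'"
      using eq_of_sub[OF M(1) C(1) all_eq[OF _ M]] eq_of_sub[OF M'(1) C(1) all_eq[OF _ M']] by simp
  next
    assume eq: "?M = ?M'"
    have "e \<in> ?C" if e: "e \<in> ?M" for e
    proof -
      obtain p q where pq: "e = {p, q}" "p \<noteq> q" using e M by (auto simp: card_2_iff)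
      define r where "r = {(p, q). {p, q} \<in> ?M \<union> ?M'}"
      \<comment> \<open>When the states agree, \<open>e\<close> is the only chord at its endpoints,
        so a chain starting at \<open>p\<close> never leaves \<open>e\<close>.\<close>
      have "q' \<in> e" if "(p, q') \<in> r\<^sup>*" for q'
        using that
      proof induction
        case (step y z)
        then have "{y, z} \<in> ?M" using eq by (simp add: r_def)
        then have "{y, z} = e" using step.IH e disjointD[OF partition_onD2[OF M(1)], of "{y, z}" e] by blast
        then show ?case by blast
      qed (simp add: pq)
      moreover have "(p, q) \<in> r" using pq e by (simp add: r_def)
      ultimately have "e = r\<^sup>* `` {p}" using pq by auto
      moreover have "p < 2 * n" using M(1) e pq by (auto simp: partition_on_def)
      ultimately show "e \<in> ?C" unfolding closed_curves_def r_def[symmetric] by (auto simp: quotient_def)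
    qed
    then have "?M = ?C" using eq_of_sub[OF M(1) C(1)] by blast
    then show "card ?C = n" using card_matching[OF M(1) _ M(2)] by simp
  qed
qed

section \<open>Regions\<close>

lemma catalan_state_chordE:
  assumes M: "M \<in> catalan_states n" and e: "e \<in> M"
  obtains p q where "e = {p, q}" "p < q" "q < 2 * n" "Min e = p" "Max e = q"
proof -
  have "card e = 2" "e \<subseteq> {..<2 * n}" using assms by (auto simp: catalan_states_def partition_on_def)
  then obtain a b where "e = {a, b}" "a \<noteq> b" "a < 2 * n" "b < 2 * n" by (auto simp: card_2_iff)
  then show thesis using that[of a b] that[of b a] by (cases "a < b") auto
qed

text \<open>A region is determined by the set of chords that lie over its arcs. A nonempty such set
  is determined by its innermost chord, which gives one region per chord; the empty set gives the
  outer region.\<close>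

lemma card_regions:
  assumes "n \<ge> 1" and M: "M \<in> catalan_states n"
  shows "card (regions n M) = n + 1"
proof -
  \<comment> \<open>\<open>E k\<close> collects the chords over arc \<open>k\<close>, seen as
    intervals of arcs.\<close>
  define E where "E k = {e \<in> M. k \<in> {Min e..<Max e}}" for k
  note chordE = catalan_state_chordE[OF M]
  have part: "partition_on {..<2 * n} M" and "\<forall>e\<in>M. card e = 2"
    using M by (auto simp: catalan_states_def)
  then have card_M: "card M = n" using card_matching[OF part finite_lessThan] by simp
  have fin_M: "finite M" by (rule finite_elements[OF finite_lessThan part])
  have disj: "e = f" if "e \<in> M" "f \<in> M" "e \<inter> f \<noteq> {}" for e f
    using that disjointD[OF partition_onD2[OF part]] by blast
  have Min_in: "Min e \<in> e" and Max_in: "Max e \<in> e" and Min_Max: "Min e < Max e" and Max_lt: "Max e < 2 * n"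
    if e: "e \<in> M" for e
    by (rule chordE[OF e]; simp)+
  have nc: False if "e \<in> M" "f \<in> M" "Min e < Min f" "Min f < Max e" "Max e < Max f" for e f
  proof -
    have "{Min e, Max e} = e" "{Min f, Max f} = f"
      by (rule chordE[OF \<open>e \<in> M\<close>], simp) (rule chordE[OF \<open>f \<in> M\<close>], simp)
    then have "{Min e, Max e} \<in> M" "{Min f, Max f} \<in> M" using that by simp_all
    then show False using M that(3-5) unfolding catalan_states_def by blast
  qed
  \<comment> \<open>The chord over arc \<open>k\<close> with the largest left end is the innermost
    one. A chord over its first arc that ended at or before \<open>k\<close> would have to cross
    it.\<close>
  have E_innermost: "E k = E (Min e)"
    if e: "e \<in> E k" and max: "\<And>f. f \<in> E k \<Longrightarrow> Min f \<le> Min e" for k e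
  proof (intro equalityI subsetI)
    have eM: "e \<in> M" and k: "Min e \<le> k" "k < Max e" using e by (auto simp: E_def)
    fix f
    show "f \<in> E (Min e)" if "f \<in> E k" using max[OF that] that k by (auto simp: E_def)
    assume "f \<in> E (Min e)"
    then have f: "f \<in> M" "Min f \<le> Min e" "Min e < Max f" by (auto simp: E_def)
    have "k < Max f"
    proof (rule ccontr)
      assume "\<not> k < Max f"
      moreover have "f \<noteq> e" using calculation k by auto
      then have "Min f \<noteq> Min e" using disj[OF f(1) eM] Min_in[OF f(1)] Min_in[OF eM] by force
      ultimately show False using nc[OF f(1) eM] f k by linarith
    qed
    then show "f \<in> E k" using f k by (auto simp: E_def)
  qed
  \<comment> \<open>Regions are the fibres of \<open>E\<close>, hence correspond to the values that
    \<open>E\<close> takes.\<close>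
  have "regions n M = (\<lambda>S. {k \<in> {..<2 * n}. E k = S}) ` E ` {..<2 * n}"
  proof -
    have "(k, l) \<in> same_region n M \<longleftrightarrow> k < 2 * n \<and> l < 2 * n \<and> E l = E k" for k l
      unfolding same_region_def chord_separates_def E_def by blast
    then have "same_region n M `` {k} = {l \<in> {..<2 * n}. E l = E k}" if "k < 2 * n" for k
      using that by auto
    then show ?thesis unfolding regions_def quotient_def by (auto simp: image_image)
  qed
  moreover have "inj_on (\<lambda>S. {k \<in> {..<2 * n}. E k = S}) (E ` {..<2 * n})"
    by (rule inj_onI) auto
  ultimately have "card (regions n M) = card (E ` {..<2 * n})" by (simp add: card_image)
  also have "E ` {..<2 * n} = insert {} ((\<lambda>e. E (Min e)) ` M)"
  proof (intro equalityI subsetI)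
    fix S assume "S \<in> E ` {..<2 * n}"
    then obtain k where k: "S = E k" by auto
    show "S \<in> insert {} ((\<lambda>e. E (Min e)) ` M)"
    proof (cases "E k = {}")
      case False
      have "finite (E k)" using fin_M by (simp add: E_def)
      then have "Max (Min ` E k) \<in> Min ` E k" using False by simp
      then obtain e where "e \<in> E k" "Max (Min ` E k) = Min e" by auto
      moreover then have "Min f \<le> Min e" if "f \<in> E k" for f
        using that \<open>finite (E k)\<close> Max_ge[of "Min ` E k" "Min f"] by simp
      ultimately have "E k = E (Min e)" "e \<in> M" using E_innermost by (auto simp: E_def)
      then show ?thesis using k by blast
    qed (simp add: k)
  next
    fix S assume "S \<in> insert {} ((\<lambda>e. E (Min e)) ` M)"
    \<comment> \<open>The last arc joins the last marked point to the first and lies under no chord;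
      it exists because \<open>n\<close> is positive.\<close>
    moreover have "E (2 * n - 1) = {}" using Max_lt by (fastforce simp: E_def)
    moreover have "2 * n - 1 \<in> {..<2 * n}" using assms(1) by simp
    moreover have "Min e \<in> {..<2 * n}" if "e \<in> M" for e using Min_Max[OF that] Max_lt[OF that] by simp
    ultimately show "S \<in> E ` {..<2 * n}" by blast
  qed
  also have "card \<dots> = n + 1"
  proof -
    have self: "e \<in> E (Min e)" if "e \<in> M" for e using that Min_Max by (simp add: E_def)
    \<comment> \<open>Each chord lies over its own first arc, so equal values force equal left ends,
      and chords sharing an endpoint coincide.\<close>
    have "inj_on (\<lambda>e. E (Min e)) M"
    proof (rule inj_onI)
      fix e f assume ef: "e \<in> M" "f \<in> M" "E (Min e) = E (Min f)"
      then have "e \<in> E (Min f)" "f \<in> E (Min e)" using self by blast+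
      then have "Min e = Min f" by (simp add: E_def)
      then show "e = f" using disj[OF ef(1,2)] Min_in[OF ef(1)] Min_in[OF ef(2)] by force
    qed
    then show ?thesis using self fin_M card_M by (subst card_insert_disjoint) (auto simp: card_image)
  qed
  finally show ?thesis .
qed

section \<open>Counting Catalan states\<close>

text \<open>
  Removing the last point of a non-crossing matching leaves its partner unmatched. So matchings are
  counted together with partial ones, whose \<open>k\<close> unmatched points must not lie under a chord.
\<close>

definition partial_states :: "nat \<Rightarrow> nat \<Rightarrow> nat set set set" where
  "partial_states m k =
    {M. M \<subseteq> Pow {..<m} \<and> disjoint M \<and> (\<forall>e\<in>M. card e = 2) \<and>
        \<not> (\<exists>a b c d. a < b \<and> b < c \<and> c < d \<and> {a, c} \<in> M \<and> {b, d} \<in> M) \<and>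
        \<not> (\<exists>a b c. a < b \<and> b < c \<and> {a, c} \<in> M \<and> b \<notin> \<Union>M) \<and>
        card ({..<m} - \<Union>M) = k}"

lemma finite_partial_states: "finite (partial_states m k)"
  by (rule finite_subset[of _ "Pow (Pow {..<m})"]) (auto simp: partial_states_def)

lemma partial_statesD:
  assumes "M \<in> partial_states m k"
  shows "M \<subseteq> Pow {..<m}" and "disjoint M" and "\<forall>e\<in>M. card e = 2"
    and "a < b \<Longrightarrow> b < c \<Longrightarrow> c < d \<Longrightarrow> {a, c} \<in> M \<Longrightarrow> {b, d} \<in> M \<Longrightarrow> False"
    and "a < b \<Longrightarrow> b < c \<Longrightarrow> {a, c} \<in> M \<Longrightarrow> b \<in> \<Union>M"
    and "card ({..<m} - \<Union>M) = k"
proof -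
  note * = assms[unfolded partial_states_def mem_Collect_eq]
  show "M \<subseteq> Pow {..<m}" "disjoint M" "\<forall>e\<in>M. card e = 2" "card ({..<m} - \<Union>M) = k"
    using * by simp_all
  show False if "a < b" "b < c" "c < d" "{a, c} \<in> M" "{b, d} \<in> M"
    using * that by blast
  show "b \<in> \<Union>M" if "a < b" "b < c" "{a, c} \<in> M"
    using * that by blast
qed

lemma partial_statesI:
  assumes "M \<subseteq> Pow {..<m}" and "disjoint M" and "\<forall>e\<in>M. card e = 2"
    and "\<And>a b c d. a < b \<Longrightarrow> b < c \<Longrightarrow> c < d \<Longrightarrow> {a, c} \<in> M \<Longrightarrow> {b, d} \<in> M \<Longrightarrow> False"
    and "\<And>a b c. a < b \<Longrightarrow> b < c \<Longrightarrow> {a, c} \<in> M \<Longrightarrow> b \<in> \<Union>M"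
    and "card ({..<m} - \<Union>M) = k"
  shows "M \<in> partial_states m k"
  unfolding partial_states_def mem_Collect_eq
proof (intro conjI)
  show "\<not> (\<exists>a b c d. a < b \<and> b < c \<and> c < d \<and> {a, c} \<in> M \<and> {b, d} \<in> M)"
    using assms(4) by blast
  show "\<not> (\<exists>a b c. a < b \<and> b < c \<and> {a, c} \<in> M \<and> b \<notin> \<Union>M)"
    using assms(5) by blast
qed fact+

text \<open>With no unmatched point the chords exhaust \<open>{..<2 * n}\<close>, and then no
  unmatched point can lie under a chord.\<close>

lemma catalan_states_eq_partial_states: "catalan_states n = partial_states (2 * n) 0"
proof (intro equalityI subsetI)
  fix M assume M: "M \<in> catalan_states n"
  then have part: "partition_on {..<2 * n} M" by (simp add: catalan_states_def)
  have U: "\<Union>M = {..<2 * n}" using partition_onD1[OF part] by simp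
  have "b \<in> \<Union>M" if "{a, c} \<in> M" "b < c" for a b c :: nat
  proof -
    have "c \<in> \<Union>M" using that(1) by blast
    then show ?thesis using that(2) unfolding U by simp
  qed
  then show "M \<in> partial_states (2 * n) 0"
    using M partition_onD2[OF part] U unfolding catalan_states_def partial_states_def by auto
next
  fix M assume M: "M \<in> partial_states (2 * n) 0"
  then have "\<Union>M \<subseteq> {..<2 * n}" "{..<2 * n} - \<Union>M = {}" by (auto simp: partial_states_def)
  moreover have "{} \<notin> M" using M by (auto simp: partial_states_def)
  ultimately show "M \<in> catalan_states n"
    using M by (auto simp: partial_states_def catalan_states_def partition_on_def)
qed

lemma partial_states_0: "partial_states 0 0 = {{}}"
proof -
  have "M = {}" if "M \<in> partial_states 0 0" for M
  proof -
    have "M \<subseteq> {{}}" "{} \<notin> M" using that by (auto simp: partial_states_def)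
    then show ?thesis by blast
  qed
  moreover have "{} \<in> partial_states 0 0" by (simp add: partial_states_def)
  ultimately show ?thesis by blast
qed

lemma partial_states_empty: "m < k \<Longrightarrow> partial_states m k = {}"
  using card_mono[of "{..<m}" "{..<m} - \<Union>M" for M] by (auto simp: partial_states_def not_less[symmetric])

text \<open>An unmatched last point lies under no chord, so dropping it only lowers the number of
  unmatched points by one.\<close>

lemma partial_states_last_unmatched:
  "{M \<in> partial_states (Suc m) k. m \<notin> \<Union>M} =
    (if k = 0 then {} else partial_states m (k - 1))"
proof -
  have "M \<in> partial_states (Suc m) k \<and> m \<notin> \<Union>M \<longleftrightarrow> k \<noteq> 0 \<and> M \<in> partial_states m (k - 1)" for M
  proof -
    have sub: "M \<subseteq> Pow {..<Suc m} \<and> m \<notin> \<Union>M \<longleftrightarrow> M \<subseteq> Pow {..<m}"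
      by (force simp: less_Suc_eq)
    have "card ({..<Suc m} - \<Union>M) = Suc (card ({..<m} - \<Union>M))" if "m \<notin> \<Union>M"
    proof -
      have "{..<Suc m} - \<Union>M = insert m ({..<m} - \<Union>M)" using that by auto
      then show ?thesis by simp
    qed
    then have "m \<notin> \<Union>M \<Longrightarrow> card ({..<Suc m} - \<Union>M) = k \<longleftrightarrow> k \<noteq> 0 \<and> card ({..<m} - \<Union>M) = k - 1"
      by auto
    then show ?thesis using sub unfolding partial_states_def mem_Collect_eq by meson
  qed
  then show ?thesis by auto
qed

text \<open>Joining the new point to the largest unmatched \<open>p\<close> covers only matched
  points. A chord crossing the new one would have \<open>p\<close> under it, which is excluded in
  \<open>M\<close>.\<close>

lemma partial_states_insert:
  assumes M: "M \<in> partial_states m (Suc k)"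
  defines "p \<equiv> Max ({..<m} - \<Union>M)"
  shows "insert {p, m} M \<in> partial_states (Suc m) k" and "{e \<in> insert {p, m} M. m \<notin> e} = M"
proof -
  let ?N = "insert {p, m} M"
  note sub = partial_statesD(1)[OF M] and disj = partial_statesD(2)[OF M]
    and two = partial_statesD(3)[OF M] and nc = partial_statesD(4)[OF M]
    and un = partial_statesD(5)[OF M] and card = partial_statesD(6)[OF M]
  \<comment> \<open>The count \<open>Suc k\<close> guarantees an unmatched point, so the maximum
    defining \<open>p\<close> is attained.\<close>
  have ne: "{..<m} - \<Union>M \<noteq> {}" using card by force
  have p: "p < m" "p \<notin> \<Union>M" using Max_in[OF _ ne] by (auto simp: p_def)
  have p_max: "u \<le> p" if "u < m" "u \<notin> \<Union>M" for u using that by (auto simp: p_def)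
  have lt: "a < m" if "a \<in> e" "e \<in> M" for a e using that sub by auto
  show "?N \<in> partial_states (Suc m) k"
  proof (rule partial_statesI)
    show "?N \<subseteq> Pow {..<Suc m}" using lt p by (auto simp: less_Suc_eq)
    show "disjoint ?N" using disj p lt by (fastforce simp: pairwise_insert disjnt_def)
    show "\<forall>e\<in>?N. card e = 2" using two p by simp
  next
    fix a b c d assume abcd: "a < b" "b < c" "c < d" and ac: "{a, c} \<in> ?N" and bd: "{b, d} \<in> ?N"
    have d: "d \<le> m" using bd lt[of d "{b, d}"] p(1) by (auto simp: doubleton_eq_iff)
    then have "{a, c} \<in> M" using ac abcd by (auto simp: doubleton_eq_iff)
    moreover have "{b, d} \<notin> M" using nc[OF abcd calculation] by blast
    then have "b = p" using bd d abcd p(1) by (auto simp: doubleton_eq_iff)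
    ultimately show False using un[of a p c] abcd p(2) by simp
  next
    fix a b c assume abc: "a < b" "b < c" and ac: "{a, c} \<in> ?N"
    show "b \<in> \<Union>?N"
    proof (rule ccontr)
      assume b: "b \<notin> \<Union>?N"
      then have "{a, c} = {p, m}" using un[OF abc] ac by auto
      then have "a = p" "c = m" using abc p(1) by (auto simp: doubleton_eq_iff)
      then show False using p_max[of b] abc b by simp
    qed
  next
    have "{..<Suc m} - \<Union>?N = ({..<m} - \<Union>M) - {p}" by (auto simp: less_Suc_eq)
    then show "card ({..<Suc m} - \<Union>?N) = k" using p card by simp
  qed
  show "{e \<in> ?N. m \<notin> e} = M" using lt by auto
qed

text \<open>The inverse construction: the points between \<open>p\<close> and its partner
  \<open>m\<close> lie under their chord, hence are matched, so \<open>p\<close> is recovered as the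
  largest unmatched point once the chord is removed.\<close>

lemma partial_states_remove:
  assumes M: "M \<in> partial_states (Suc m) k" and m: "m \<in> \<Union>M"
  defines "N \<equiv> {e \<in> M. m \<notin> e}"
  shows "N \<in> partial_states m (Suc k)" and "insert {Max ({..<m} - \<Union>N), m} N = M"
proof -
  note sub = partial_statesD(1)[OF M] and disj = partial_statesD(2)[OF M]
    and two = partial_statesD(3)[OF M] and nc = partial_statesD(4)[OF M]
    and un = partial_statesD(5)[OF M] and card = partial_statesD(6)[OF M]
  obtain e where e: "e \<in> M" "m \<in> e" using m by blast
  then obtain x y where "e = {x, y}" "x \<noteq> y" using two by (auto simp: card_2_iff)
  then obtain p where p: "e = {p, m}" "p \<noteq> m" using e(2) by auto
  have "e \<subseteq> {..<Suc m}" using e(1) sub by blast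
  then have pm: "p < m" using p by simp
  have uniq: "f = e" if "f \<in> M" "f \<inter> e \<noteq> {}" for f using disjointD[OF disj that(1) e(1)] that(2) by blast
  have M_eq: "M = insert e N" using e uniq by (auto simp: N_def)
  have N_sub: "N \<subseteq> M" by (auto simp: N_def)
  have p_notin: "p \<notin> \<Union>N" using uniq p by (auto simp: N_def)
  have m_notin: "m \<notin> \<Union>N" by (auto simp: N_def)
  have U: "{..<m} - \<Union>N = insert p ({..<Suc m} - \<Union>M)"
  proof -
    have "\<Union>M = insert p (insert m (\<Union>N))" using M_eq p(1) by simp
    then show ?thesis using pm p_notin by auto
  qed
  have lt: "a < m" if "a \<in> f" "f \<in> N" for a f
  proof -
    have "a < Suc m" using that N_sub sub by auto
    moreover have "a \<noteq> m" using that m_notin by blast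
    ultimately show ?thesis by simp
  qed
  show "N \<in> partial_states m (Suc k)"
  proof (rule partial_statesI)
    show "card ({..<m} - \<Union>N) = Suc k"
      using card p e(1) unfolding U by (subst card_insert_disjoint) auto
    show "N \<subseteq> Pow {..<m}" using lt by auto
    show "disjoint N" using pairwise_subset[OF disj N_sub] .
    show "\<forall>e\<in>N. card e = 2" using two N_sub by blast
    show False if "a < b" "b < c" "c < d" "{a, c} \<in> N" "{b, d} \<in> N" for a b c d
      using nc[OF that(1-3)] that(4,5) N_sub by blast
  next
    fix a b c assume abc: "a < b" "b < c" and ac: "{a, c} \<in> N"
    have c: "c < m" using lt[OF _ ac] by simp
    have "b \<in> \<Union>M" using un[OF abc] ac N_sub by blast
    \<comment> \<open>A chord of \<open>N\<close> over \<open>p\<close> ends before \<open>m\<close>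
      and would cross the chord from \<open>p\<close> to \<open>m\<close>.\<close>
    moreover have "b \<noteq> p" using nc[of a p c m] abc ac c e(1) p(1) N_sub by blast
    moreover have "\<Union>M = e \<union> \<Union>N" using M_eq by blast
    ultimately show "b \<in> \<Union>N" using abc c p(1) by auto
  qed
  have "u \<le> p" if "u \<in> {..<Suc m} - \<Union>M" for u
  proof (rule ccontr)
    assume "\<not> u \<le> p"
    moreover have "u \<noteq> m" using that m by blast
    then have "u < m" using that by simp
    ultimately have "u \<in> \<Union>M" using un[of p u m] e(1) p(1) by simp
    then show False using that by blast
  qed
  then have "Max ({..<m} - \<Union>N) = p" unfolding U by (intro Max_eqI) auto
  then show "insert {Max ({..<m} - \<Union>N), m} N = M" using M_eq p by simp
qed

text \<open>The ballot recurrence, by whether the last point is unmatched or matched; the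
  conditional keeps \<open>k - 1\<close> away from truncated subtraction.\<close>

lemma card_partial_states_Suc:
  "card (partial_states (Suc m) k) =
    (if k = 0 then 0 else card (partial_states m (k - 1))) + card (partial_states m (Suc k))"
proof -
  let ?S = "partial_states (Suc m) k"
  have "bij_betw (\<lambda>M. insert {Max ({..<m} - \<Union>M), m} M) (partial_states m (Suc k)) {M \<in> ?S. m \<in> \<Union>M}"
  proof (rule bij_betw_byWitness[where f' = "\<lambda>M. {e \<in> M. m \<notin> e}"])
    show "\<forall>M\<in>partial_states m (Suc k). {e \<in> insert {Max ({..<m} - \<Union>M), m} M. m \<notin> e} = M"
      using partial_states_insert(2) by blast
    show "\<forall>M\<in>{M \<in> ?S. m \<in> \<Union>M}.
        insert {Max ({..<m} - \<Union>{e \<in> M. m \<notin> e}), m} {e \<in> M. m \<notin> e} = M"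
      using partial_states_remove(2) by blast
    show "(\<lambda>M. insert {Max ({..<m} - \<Union>M), m} M) ` partial_states m (Suc k) \<subseteq> {M \<in> ?S. m \<in> \<Union>M}"
      using partial_states_insert(1) by blast
    show "(\<lambda>M. {e \<in> M. m \<notin> e}) ` {M \<in> ?S. m \<in> \<Union>M} \<subseteq> partial_states m (Suc k)"
      using partial_states_remove(1) by blast
  qed
  then have "card {M \<in> ?S. m \<in> \<Union>M} = card (partial_states m (Suc k))"
    by (rule bij_betw_same_card[symmetric])
  moreover have "card ?S = card {M \<in> ?S. m \<notin> \<Union>M} + card {M \<in> ?S. m \<in> \<Union>M}"
    using finite_partial_states
    by (subst card_Un_disjoint[symmetric]) (auto intro!: arg_cong[where f = card])
  ultimately show ?thesis unfolding partial_states_last_unmatched by simp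
qed

text \<open>Here \<open>d\<close> is the number of chords. The ballot number is a difference of
  neighbouring binomial coefficients, written additively to avoid subtraction; the conditional
  stands for a coefficient with lower index -1. The induction combines the recurrence with Pascal's
  rule.\<close>

lemma card_partial_states:
  "m = 2 * d + k \<Longrightarrow>
    card (partial_states m k) + (if d = 0 then 0 else m choose (d - 1)) = m choose d"
proof (induction m arbitrary: d k)
  case 0
  then show ?case by (simp add: partial_states_0)
next
  case (Suc m)
  show ?case
  proof (cases d)
    case 0
    then have "k = Suc m" using Suc.prems by simp
    then show ?thesis using Suc.IH[of 0 m] 0 by (simp add: card_partial_states_Suc partial_states_empty)
  next
    case (Suc e)
    have m: "m = 2 * e + Suc k" using Suc.prems Suc by simp
    have IH2: "card (partial_states m (Suc k)) + (if e = 0 then 0 else m choose (e - 1)) = m choose e"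
      using Suc.IH[OF m] .
    have e: "Suc m choose e = (m choose e) + (if e = 0 then 0 else m choose (e - 1))"
      by (cases e) simp_all
    show ?thesis
    proof (cases k)
      case 0
      \<comment> \<open>For \<open>k = 0\<close> the recurrence lacks its first term;
        correspondingly \<open>m\<close> is odd and its two middle binomial coefficients
        agree.\<close>
      have "m choose e = m choose Suc e" using m 0 binomial_symmetric[of e m] by simp
      then show ?thesis using IH2 e Suc 0 by (simp add: card_partial_states_Suc)
    next
      case (Suc l)
      have "m = 2 * d + l" using Suc.prems Suc by simp
      from Suc.IH[OF this] show ?thesis
        using IH2 e \<open>d = Suc e\<close> Suc by (simp add: card_partial_states_Suc)
    qed
  qed
qed

lemma card_catalan_states: "(n + 1) * card (catalan_states n) = 2 * n choose n"
proof (cases n)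
  case 0
  then show ?thesis by (simp add: catalan_states_eq_partial_states partial_states_0)
next
  case (Suc l)
  have *: "card (catalan_states n) + (2 * n choose l) = 2 * n choose n"
    using card_partial_states[of "2 * n" n 0] Suc by (simp add: catalan_states_eq_partial_states)
  \<comment> \<open>This ratio of neighbouring coefficients turns the ballot difference into the
    Catalan number.\<close>
  have "n * (2 * n choose n) = (n + 1) * (2 * n choose l)"
    using binomial_absorb_comp[of "2 * n" l] binomial_absorption[of l "2 * n"] Suc
    by (simp add: algebra_simps)
  moreover have "(n + 1) * card (catalan_states n) + (n + 1) * (2 * n choose l) = (n + 1) * (2 * n choose n)"
    unfolding *[symmetric] by (simp add: algebra_simps)
  ultimately show ?thesis by (simp add: algebra_simps)
qed

section \<open>The Gram determinant\<close>

text \<open>The classes are the fibres of \<open>catalan_state\<close>, a form better suited to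
  counting and to reading off the blocks.\<close>

lemma state_classes_eq:
  "state_classes n = (\<lambda>M. {b \<in> diagrams n. catalan_state b = M}) ` catalan_state ` diagrams n"
proof -
  have "{(b, b'). b \<in> diagrams n \<and> b' \<in> diagrams n \<and> catalan_state b = catalan_state b'} `` {b} =
      {b' \<in> diagrams n. catalan_state b' = catalan_state b}" if "b \<in> diagrams n" for b
    using that by auto
  then show ?thesis unfolding state_classes_def quotient_def image_image by auto
qed

lemma diagrams_eq_Sigma: "diagrams n = Sigma (catalan_states n) (\<lambda>M. regions n M \<times> regions n M)"
  by (auto simp: diagrams_def)

lemma finite_catalan_states: "finite (catalan_states n)"
  unfolding catalan_states_eq_partial_states by (rule finite_partial_states)

text \<open>Every state has a region in which to put both holes, so no fibre is empty.\<close>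

lemma catalan_state_image_diagrams:
  assumes "n \<ge> 1"
  shows "catalan_state ` diagrams n = catalan_states n"
proof (intro equalityI subsetI)
  fix M assume M: "M \<in> catalan_states n"
  then obtain r where "r \<in> regions n M" using card_regions[OF assms M] by fastforce
  then have "(M, r, r) \<in> diagrams n" using M by (simp add: diagrams_def)
  then show "M \<in> catalan_state ` diagrams n" by (force simp: catalan_state_def)
qed (auto simp: diagrams_def catalan_state_def)

text \<open>Each state allows \<open>(n + 1) * (n + 1)\<close> placements of the two holes; one
  factor is absorbed by the Catalan denominator.\<close>

lemma card_diagrams:
  assumes "n \<ge> 1"
  shows "card (diagrams n) = (n + 1) * (2 * n choose n)"
proof -
  have fin: "finite (regions n M)" if "M \<in> catalan_states n" for M
    using card_regions[OF assms that] by (intro card_ge_0_finite) simp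
  have "card (diagrams n) = (\<Sum>M\<in>catalan_states n. card (regions n M) * card (regions n M))"
    unfolding diagrams_eq_Sigma
    using fin finite_catalan_states by (subst card_SigmaI) (auto simp: card_cartesian_product)
  also have "\<dots> = (\<Sum>M\<in>catalan_states n. (n + 1) * (n + 1))"
    by (rule sum.cong) (simp_all only: card_regions[OF assms])
  also have "\<dots> = (n + 1) * ((n + 1) * card (catalan_states n))"
    by (simp only: sum_constant mult_ac of_nat_id)
  finally show ?thesis by (simp only: card_catalan_states)
qed

lemma card_state_classes:
  assumes "n \<ge> 1"
  shows "card (state_classes n) = catalan_number n"
proof -
  have "inj_on (\<lambda>M. {b \<in> diagrams n. catalan_state b = M}) (catalan_state ` diagrams n)"
    by (rule inj_onI) auto
  then have "card (state_classes n) = card (catalan_states n)"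
    unfolding state_classes_eq by (simp add: card_image catalan_state_image_diagrams[OF assms])
  moreover have "(n + 1) * card (catalan_states n) div (n + 1) = card (catalan_states n)"
    by (rule nonzero_mult_div_cancel_left) simp
  ultimately show ?thesis by (simp only: catalan_number_def card_catalan_states)
qed

text \<open>The product is a single monomial, so truncation keeps it or kills it. Its degree is a
  sum of curve counts, each at most \<open>n\<close>, and reaches the bound only if every factor
  pairs equal states.\<close>

lemma homogeneous_part_prod_pairing:
  assumes "finite S"
    and f: "\<And>i. i \<in> S \<Longrightarrow> catalan_state (f i) \<in> catalan_states n"
    and g: "\<And>i. i \<in> S \<Longrightarrow> catalan_state (g i) \<in> catalan_states n"
  shows "homogeneous_part (n * card S) (\<Prod>i\<in>S. pairing n (f i) (g i)) =
    (\<Prod>i\<in>S. if catalan_state (f i) = catalan_state (g i) then pairing n (f i) (g i) else 0)"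
proof -
  let ?m = "\<Sum>i\<in>S. pairing_exponent n (f i) (g i)" and ?c = "\<lambda>i. card (closed_curves n (f i) (g i))"
  have prod: "(\<Prod>i\<in>S. pairing n (f i) (g i)) = Poly_Mapping.single ?m 1"
    by (simp add: pairing_eq_single prod_single_one)
  have deg: "total_degree ?m = (\<Sum>i\<in>S. ?c i)"
    by (simp add: total_degree_sum total_degree_pairing_exponent)
  have le: "?c i \<le> n" and eq: "?c i = n \<longleftrightarrow> catalan_state (f i) = catalan_state (g i)" if "i \<in> S" for i
    using card_closed_curves[OF f[OF that] g[OF that]] by auto
  show ?thesis
  proof (cases "\<forall>i\<in>S. catalan_state (f i) = catalan_state (g i)")
    case True
    then have "total_degree ?m = n * card S" using eq by (simp add: deg)
    moreover have "(\<Prod>i\<in>S. if catalan_state (f i) = catalan_state (g i) then pairing n (f i) (g i) else 0) =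
        (\<Prod>i\<in>S. pairing n (f i) (g i))"
      using True by (intro prod.cong) auto
    ultimately show ?thesis by (simp add: prod homogeneous_part_single)
  next
    case False
    then obtain i where i: "i \<in> S" "catalan_state (f i) \<noteq> catalan_state (g i)" by auto
    then have "?c i < n" using le eq by (simp add: order_neq_le_trans)
    then have "(\<Sum>i\<in>S. ?c i) < (\<Sum>i\<in>S. n)"
      using assms(1) i(1) le by (intro sum_strict_mono_ex1) auto
    then have "homogeneous_part (n * card S) (\<Prod>i\<in>S. pairing n (f i) (g i)) = 0"
      by (simp add: prod homogeneous_part_single deg mult.commute)
    also have "\<dots> = (\<Prod>i\<in>S. if catalan_state (f i) = catalan_state (g i) then pairing n (f i) (g i) else 0)"
      using assms(1) i by (intro prod_zero[symmetric]) auto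
    finally show ?thesis .
  qed
qed

theorem proposition4p1:
  fixes n :: nat and bs :: "diagram list"
  assumes "n \<ge> 1"
    and "distinct bs" and "set bs = diagrams n"
  shows "card (state_classes n) = catalan_number n \<and>
    homogeneous_part (n * (n + 1) * (2 * n choose n)) (det (gram_matrix n bs)) =
      (\<Prod>A\<in>state_classes n. det (gram_block n bs A))"
proof
  show "card (state_classes n) = catalan_number n" using assms(1) by (rule card_state_classes)
  let ?L = "length bs"
  let ?st = "\<lambda>i. catalan_state (bs ! i)"
  define G where "G i j = pairing n (bs ! i) (bs ! j)" for i j
  \<comment> \<open>\<open>H\<close> is the Gram matrix with all entries between different states
    set to 0, hence block diagonal.\<close>
  define H where "H i j = (if ?st i = ?st j then G i j else 0)" for i j
  define I where "I A = {i. i < ?L \<and> bs ! i \<in> A}" for A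
  \<comment> \<open>The truncation degree is \<open>n\<close> for each row of the matrix.\<close>
  have L: "n * (n + 1) * (2 * n choose n) = n * ?L"
    using card_diagrams[OF assms(1)] distinct_card[OF assms(2)] assms(3) by (simp only: mult.assoc)
  have st: "?st i \<in> catalan_states n" if "i < ?L" for i
    using nth_mem[OF that] assms(3) catalan_state_image_diagrams[OF assms(1)] by blast
  have gram: "gram_matrix n bs = mat ?L ?L (\<lambda>(i, j). G i j)"
    by (simp add: gram_matrix_def G_def)
  have "homogeneous_part (n * ?L) (\<Prod>i<?L. G i (p i)) = (\<Prod>i<?L. H i (p i))"
    if "p permutes {..<?L}" for p
    using homogeneous_part_prod_pairing[of "{..<?L}" "\<lambda>i. bs ! i" n "\<lambda>i. bs ! p i"]
      st permutes_in_image[OF that] unfolding G_def H_def by simp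
  then have "homogeneous_part (n * ?L) (det (gram_matrix n bs)) = set_det {..<?L} H"
    unfolding gram det_mat_eq_set_det set_det_def homogeneous_part_sum
    by (intro sum.cong) (simp_all add: homogeneous_part_sign_mult)
  also have "{..<?L} = \<Union>(I ` state_classes n)"
    using assms(3) nth_mem[of _ bs] by (auto simp: I_def state_classes_eq)
  also have "set_det \<dots> H = (\<Prod>J\<in>I ` state_classes n. set_det J H)"
  proof (rule set_det_block_diagonal)
    show "finite (I ` state_classes n)"
      unfolding state_classes_eq assms(3)[symmetric] by (intro finite_imageI finite_set)
    show "finite J" if "J \<in> I ` state_classes n" for J
      using that unfolding I_def by auto
    have *: "I {b \<in> diagrams n. catalan_state b = M} = {i. i < ?L \<and> ?st i = M}" for M
      using assms(3) nth_mem[of _ bs] by (auto simp: I_def)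
    show "disjoint (I ` state_classes n)"
      by (auto simp: state_classes_eq * disjoint_def)
    show "H i j = 0"
      if "J \<in> I ` state_classes n" "K \<in> I ` state_classes n" "J \<noteq> K" "i \<in> J" "j \<in> K" for J K i j
      using that by (auto simp: state_classes_eq * H_def)
  qed
  also have "\<dots> = (\<Prod>A\<in>state_classes n. set_det (I A) H)"
  proof (rule prod.reindex_cong[OF _ refl refl])
    \<comment> \<open>Every class is listed in \<open>bs\<close>, so it is recovered from its set of
      positions.\<close>
    show "inj_on I (state_classes n)"
    proof (rule inj_on_inverseI)
      fix A assume "A \<in> state_classes n"
      then have sub: "A \<subseteq> set bs" unfolding state_classes_eq assms(3)[symmetric] by blast
      show "(\<lambda>i. bs ! i) ` I A = A"
      proof (intro equalityI subsetI)
        fix b assume "b \<in> A"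
        moreover then obtain i where "i < ?L" "b = bs ! i" using sub by (metis in_set_conv_nth subsetD)
        ultimately show "b \<in> (\<lambda>i. bs ! i) ` I A" unfolding I_def by blast
      qed (auto simp: I_def)
    qed
  qed
  also have "\<dots> = (\<Prod>A\<in>state_classes n. det (gram_block n bs A))"
  proof (rule prod.cong[OF refl])
    fix A assume "A \<in> state_classes n"
    \<comment> \<open>Inside one class all states agree, so no entry was set to 0.\<close>
    then have "set_det (I A) H = set_det (I A) G"
      by (intro set_det_cong) (auto simp: state_classes_eq I_def H_def)
    also have "\<dots> = det (gram_block n bs A)"
      unfolding gram_block_def gram I_def by (rule det_submatrix_eq_set_det[symmetric]) auto
    finally show "set_det (I A) H = det (gram_block n bs A)" .
  qed
  finally show "homogeneous_part (n * (n + 1) * (2 * n choose n)) (det (gram_matrix n bs)) =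
      (\<Prod>A\<in>state_classes n. det (gram_block n bs A))"
    unfolding L .
qed

end
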